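(* Let $G=(V,E)$ be a connected graph of order $n>2$ with Laplacian eigenvalues $\lambda_1\ge\lambda_2\ge\cdots\ge\lambda_n$. Given a vertex subset $U\subset V$, with $m=|U|<n$, let $G[U]=(U,E[U])$ be its induced subgraph. Then $$\sum_{i=1}^{m}\lambda_i\;\ge\;\sum_{u\in U}d_u+m-|E[U]|.$$
   Context: All graphs are finite and simple. The Laplacian eigenvalues of $G$ are the eigenvalues (with multiplicity) of $L=D-A$, where $D$ is the diagonal matrix of vertex degrees and $A$ is the adjacency matrix. $d_u$ is the degree in $G$ of the vertex $u$. $E[U]$ is the set of edges of $G$ with both endpoints in $U$. *)

theory Defs
  imports
    "Graph_Theory.Digraph_Component"
    "Jordan_Normal_Form.Char_Poly"
begin

text \<open>A finite simple graph is a \<^locale>\<open>graph\<close>: a finite symmetric digraph without loops and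
  parallel arcs. An undirected edge \<open>{u, v}\<close> is represented by two opposite arcs between
  \<open>u\<close> and \<open>v\<close>, so the degree of a vertex is its \<^const>\<open>out_degree\<close>, while undirected edges have to be
  counted as two-element vertex sets rather than as arcs.\<close>

definition uedges :: "('a, 'b) pre_digraph \<Rightarrow> 'a set set" where
  "uedges G = {{u, v} | u v. u \<rightarrow>\<^bsub>G\<^esub> v}"

definition edges_within :: "('a, 'b) pre_digraph \<Rightarrow> 'a set \<Rightarrow> 'a set set" where
  "edges_within G U = {e \<in> uedges G. e \<subseteq> U}"

text \<open>Matrices are indexed by \<open>{0..<n}\<close>; the list \<open>vs\<close> is an enumeration of the vertices that
  assigns the vertex \<open>vs ! i\<close> to row and column \<open>i\<close>.\<close>

definition degree_mat :: "('a, 'b) pre_digraph \<Rightarrow> 'a list \<Rightarrow> real mat" where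
  "degree_mat G vs = mat (length vs) (length vs)
     (\<lambda>(i, j). if i = j then real (out_degree G (vs ! i)) else 0)"

definition adjacency_mat :: "('a, 'b) pre_digraph \<Rightarrow> 'a list \<Rightarrow> real mat" where
  "adjacency_mat G vs = mat (length vs) (length vs)
     (\<lambda>(i, j). if vs ! i \<rightarrow>\<^bsub>G\<^esub> vs ! j then 1 else 0)"

definition laplacian_mat :: "('a, 'b) pre_digraph \<Rightarrow> 'a list \<Rightarrow> real mat" where
  "laplacian_mat G vs = degree_mat G vs - adjacency_mat G vs"

text \<open>The eigenvalues, in decreasing order, each repeated according to its multiplicity as a root
  of the characteristic polynomial. As the Laplacian is a real symmetric matrix, all roots are
  real and this multiplicity is also the dimension of the eigenspace. Positions in the list start
  at 0, so that \<open>laplacian_eigenvalues G vs ! i\<close> is the eigenvalue usually written with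
  index \<open>i + 1\<close>.\<close>

definition laplacian_eigenvalues :: "('a, 'b) pre_digraph \<Rightarrow> 'a list \<Rightarrow> real list" where
  "laplacian_eigenvalues G vs =
     rev (sorted_list_of_multiset (proots (char_poly (laplacian_mat G vs))))"

end

theory Submission
  imports Defs
    "Jordan_Normal_Form.Schur_Decomposition"
    "Jordan_Normal_Form.Spectral_Radius"
    "HOL-Combinatorics.Permutations"
begin

text \<open>Call an edge relevant if it has an endpoint in \<open>U\<close>. The relevant edges inside \<open>U\<close> are counted
  twice by the degree sum over \<open>U\<close> and the others once, so the bound to be proved is
  \<open>e + m\<close>, where \<open>e\<close> is the number of relevant edges.

  As \<open>G\<close> is connected and \<open>U\<close> omits a vertex, the relevant edges can be split into \<open>m\<close> nonempty
  stars, one centred at each \<open>u \<in> U\<close>: peel off vertices of \<open>U\<close> that have a neighbour in the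
  complement of what is left of \<open>U\<close>. It is convenient to record the splitting as an orientation of
  all edges of \<open>G\<close>; the star at \<open>u\<close> then consists of the edges leaving \<open>u\<close>
  (\<open>exists_orientation_out_of\<close>).

  Let \<open>N\<close> be the vertex-edge incidence matrix of this orientation, so that the Laplacian is
  \<open>N N\<^sup>T\<close>, whose nonzero eigenvalues are those of \<open>N\<^sup>T N\<close>. The normalised
  indicator vectors \<open>x\<^sub>u\<close> of the stars are orthonormal since the stars are disjoint. If the star at
  \<open>u\<close> has \<open>k\<close> edges, then \<open>N x\<^sub>u\<close> has the entry \<open>sqrt k\<close> at \<open>u\<close> and \<open>- 1 / sqrt k\<close> at
  each of the \<open>k\<close> leaves, so \<open>|N x\<^sub>u|\<^sup>2 = k + 1\<close>. By the variational principle of Ky Fan, the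
  \<open>m\<close> largest eigenvalues of \<open>N\<^sup>T N\<close> have at least the sum
  \<open>\<Sum>\<^sub>u |N x\<^sub>u|\<^sup>2 = e + m\<close>.

  The matrix \<open>N\<^sup>T N\<close> is never formed: the variational principle is stated for the vectors
  \<open>g\<^sub>i = N\<^sup>T v\<^sub>i\<close>, where \<open>v\<^sub>i\<close> runs over an orthonormal eigenbasis of the Laplacian
  (\<open>sum_of_energies_le_sum_of_largest\<close>). The \<open>g\<^sub>i\<close> are orthogonal and have the eigenvalues as squared
  norms, and \<open>|N x\<^sub>u|\<^sup>2\<close> is the sum of the squared inner products of \<open>x\<^sub>u\<close> with them. The
  eigenbasis comes from the spectral theorem for real symmetric matrices
  (\<open>symmetric_real_mat_orthonormal_eigenbasis\<close>), which also relates the eigenvectors to the roots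
  of the characteristic polynomial.\<close>

section \<open>Sums of largest eigenvalues\<close>

text \<open>Expand the squared norm of the difference between \<open>x\<close> and its projection to the span of
  the \<open>w j\<close>, which is nonnegative.\<close>

lemma bessel_inequality_finite:
  fixes x :: "'a \<Rightarrow> real" and w :: "'b \<Rightarrow> 'a \<Rightarrow> real"
  assumes "finite J"
    and orth: "\<And>i j. i \<in> J \<Longrightarrow> j \<in> J \<Longrightarrow> (\<Sum>a\<in>A. w i a * w j a) = (if i = j then 1 else 0)"
  shows "(\<Sum>j\<in>J. (\<Sum>a\<in>A. x a * w j a)\<^sup>2) \<le> (\<Sum>a\<in>A. (x a)\<^sup>2)"
proof -
  define c where "c j = (\<Sum>a\<in>A. x a * w j a)" for j
  have cross: "(\<Sum>a\<in>A. x a * (\<Sum>j\<in>J. c j * w j a)) = (\<Sum>j\<in>J. (c j)\<^sup>2)"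
  proof -
    have "(\<Sum>a\<in>A. x a * (\<Sum>j\<in>J. c j * w j a)) = (\<Sum>a\<in>A. \<Sum>j\<in>J. c j * (x a * w j a))"
      by (simp add: sum_distrib_left algebra_simps)
    also have "\<dots> = (\<Sum>j\<in>J. \<Sum>a\<in>A. c j * (x a * w j a))" by (rule sum.swap)
    also have "\<dots> = (\<Sum>j\<in>J. (c j)\<^sup>2)"
      by (simp add: c_def power2_eq_square sum_distrib_left)
    finally show ?thesis .
  qed
  have square: "(\<Sum>a\<in>A. (\<Sum>j\<in>J. c j * w j a)\<^sup>2) = (\<Sum>j\<in>J. (c j)\<^sup>2)"
  proof -
    have "(\<Sum>a\<in>A. (\<Sum>j\<in>J. c j * w j a)\<^sup>2) = (\<Sum>a\<in>A. \<Sum>i\<in>J. \<Sum>j\<in>J. c i * c j * (w i a * w j a))"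
      by (simp add: power2_eq_square sum_product algebra_simps)
    also have "\<dots> = (\<Sum>i\<in>J. \<Sum>a\<in>A. \<Sum>j\<in>J. c i * c j * (w i a * w j a))" by (rule sum.swap)
    also have "\<dots> = (\<Sum>i\<in>J. \<Sum>j\<in>J. \<Sum>a\<in>A. c i * c j * (w i a * w j a))"
      by (intro sum.cong refl sum.swap)
    also have "\<dots> = (\<Sum>i\<in>J. \<Sum>j\<in>J. c i * c j * (if i = j then 1 else 0))"
      by (intro sum.cong refl) (simp add: orth flip: sum_distrib_left)
    also have "\<dots> = (\<Sum>i\<in>J. \<Sum>j\<in>J. if i = j then c i * c j else 0)"
      by (intro sum.cong refl) simp
    also have "\<dots> = (\<Sum>j\<in>J. (c j)\<^sup>2)"
      using \<open>finite J\<close> by (simp add: power2_eq_square)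
    finally show ?thesis .
  qed
  have "0 \<le> (\<Sum>a\<in>A. (x a - (\<Sum>j\<in>J. c j * w j a))\<^sup>2)" by (simp add: sum_nonneg)
  also have "\<dots> = (\<Sum>a\<in>A. (x a)\<^sup>2) - 2 * (\<Sum>a\<in>A. x a * (\<Sum>j\<in>J. c j * w j a))
      + (\<Sum>a\<in>A. (\<Sum>j\<in>J. c j * w j a)\<^sup>2)"
    by (simp add: power2_diff sum.distrib sum_subtractf sum_distrib_left algebra_simps)
  finally have "(\<Sum>j\<in>J. (c j)\<^sup>2) \<le> (\<Sum>a\<in>A. (x a)\<^sup>2)" unfolding cross square by simp
  then show ?thesis by (simp add: c_def)
qed

text \<open>Under these constraints it is best to put weight 1 on the \<open>m\<close> largest values: moving weight
  from an index \<open>\<ge> m\<close> to one \<open>< m\<close> means moving it across the threshold value \<open>l m\<close>, which never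
  decreases the sum, and unused weight can be added because the values are nonnegative.\<close>

lemma weighted_sum_le_sum_of_largest:
  fixes l b :: "nat \<Rightarrow> real"
  assumes "m < n" and mono: "\<And>i j. i \<le> j \<Longrightarrow> j < n \<Longrightarrow> l j \<le> l i"
    and nonneg: "\<And>i. i < n \<Longrightarrow> 0 \<le> l i"
    and b: "\<And>i. i < n \<Longrightarrow> 0 \<le> b i" "\<And>i. i < n \<Longrightarrow> b i \<le> 1"
    and total: "(\<Sum>i<n. b i) \<le> real m"
  shows "(\<Sum>i<n. l i * b i) \<le> (\<Sum>i<m. l i)"
proof -
  have split: "(\<Sum>i<n. f i) = (\<Sum>i<m. f i) + (\<Sum>i=m..<n. f i)" for f :: "nat \<Rightarrow> real"
    using \<open>m < n\<close> sum.atLeastLessThan_concat[of 0 m n f] by (simp add: atLeast0LessThan)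
  have head: "(\<Sum>i<m. l i * b i) \<le> (\<Sum>i<m. l i - l m * (1 - b i))"
  proof (rule sum_mono)
    fix i assume "i \<in> {..<m}"
    then have "l m * (1 - b i) \<le> l i * (1 - b i)"
      using \<open>m < n\<close> mono[of i m] b(2)[of i] by (intro mult_right_mono) auto
    then show "l i * b i \<le> l i - l m * (1 - b i)" by (simp add: algebra_simps)
  qed
  have tail: "(\<Sum>i=m..<n. l i * b i) \<le> (\<Sum>i=m..<n. l m * b i)"
    using mono[of m] b(1) by (intro sum_mono mult_right_mono) auto
  have "(\<Sum>i<n. l i * b i) \<le> (\<Sum>i<m. l i) + l m * ((\<Sum>i<n. b i) - real m)"
  proof -
    have "(\<Sum>i<m. l i - l m * (1 - b i)) = (\<Sum>i<m. l i) - l m * (real m - (\<Sum>i<m. b i))"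
      by (simp add: sum_subtractf flip: sum_distrib_left)
    moreover have "(\<Sum>i=m..<n. l m * b i) = l m * (\<Sum>i=m..<n. b i)"
      by (simp add: sum_distrib_left)
    ultimately show ?thesis
      using head tail unfolding split[of "\<lambda>i. l i * b i"] split[of b] by (simp add: algebra_simps)
  qed
  also have "\<dots> \<le> (\<Sum>i<m. l i)"
    using total nonneg[OF \<open>m < n\<close>] by (simp add: mult_nonneg_nonpos)
  finally show ?thesis .
qed

text \<open>The variational principle of Ky Fan for the positive semidefinite form
  \<open>x \<mapsto> \<Sum>i<n. (g i \<bullet> x)\<^sup>2\<close>, whose nonzero eigenvalues are the nonzero \<open>l i\<close>, with eigenvectors
  \<open>g i\<close>; the value of the form at \<open>x\<close> is called the energy of \<open>x\<close>. Normalise the \<open>g i\<close> to \<open>w i\<close>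
  and let \<open>b i\<close> be the squared norm of the projection of \<open>w i\<close> to the span of the \<open>x u\<close>. The
  left-hand side is then \<open>\<Sum>i<n. l i * b i\<close>. The inequality of Bessel, used once for the family
  \<open>x\<close> and once for the family \<open>w\<close>, gives \<open>b i \<le> 1\<close> and \<open>\<Sum>i<n. b i \<le> card U\<close>.\<close>

lemma sum_of_energies_le_sum_of_largest:
  fixes g :: "nat \<Rightarrow> 'e \<Rightarrow> real" and x :: "'u \<Rightarrow> 'e \<Rightarrow> real" and l :: "nat \<Rightarrow> real"
  assumes "finite U" "card U < n"
    and mono: "\<And>i j. i \<le> j \<Longrightarrow> j < n \<Longrightarrow> l j \<le> l i"
    and g: "\<And>i j. i < n \<Longrightarrow> j < n \<Longrightarrow> (\<Sum>a\<in>A. g i a * g j a) = (if i = j then l i else 0)"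
    and x: "\<And>u v. u \<in> U \<Longrightarrow> v \<in> U \<Longrightarrow> (\<Sum>a\<in>A. x u a * x v a) = (if u = v then 1 else 0)"
  shows "(\<Sum>u\<in>U. \<Sum>i<n. (\<Sum>a\<in>A. g i a * x u a)\<^sup>2) \<le> (\<Sum>i<card U. l i)"
proof -
  have norm_g: "(\<Sum>a\<in>A. (g i a)\<^sup>2) = l i" if "i < n" for i
    using g[OF that that] by (simp add: power2_eq_square)
  have nonneg: "0 \<le> l i" if "i < n" for i
    by (simp add: sum_nonneg flip: norm_g[OF that])
  \<comment> \<open>If \<open>l i = 0\<close>, then \<open>g i\<close> vanishes on \<open>A\<close>, and division by 0 makes \<open>w i\<close> the zero vector.\<close>
  define w where "w i a = g i a / sqrt (l i)" for i a
  define b where "b i = (\<Sum>u\<in>U. (\<Sum>a\<in>A. w i a * x u a)\<^sup>2)" for i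
  have b_le: "b i \<le> (\<Sum>a\<in>A. (w i a)\<^sup>2)" for i
    unfolding b_def by (rule bessel_inequality_finite) (use assms in auto)
  have norm_w: "(\<Sum>a\<in>A. (w i a)\<^sup>2) = (if l i = 0 then 0 else 1)" if "i < n" for i
    using nonneg[OF that]
    by (simp add: w_def power_divide norm_g[OF that] flip: sum_divide_distrib)
  have scale: "(\<Sum>u\<in>U. (\<Sum>a\<in>A. g i a * x u a)\<^sup>2) = l i * b i" if "i < n" for i
  proof (cases "l i = 0")
    case True
    have "(\<Sum>u\<in>U. (\<Sum>a\<in>A. g i a * x u a)\<^sup>2) \<le> (\<Sum>a\<in>A. (g i a)\<^sup>2)"
      by (rule bessel_inequality_finite) (use assms in auto)
    then show ?thesis
      using True norm_g[OF that] by (simp add: sum_nonneg antisym)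
  next
    case False
    then have "g i a = sqrt (l i) * w i a" for a by (simp add: w_def)
    then have "(\<Sum>a\<in>A. g i a * x u a) = sqrt (l i) * (\<Sum>a\<in>A. w i a * x u a)" for u
      by (simp add: sum_distrib_left mult.assoc)
    then have "(\<Sum>a\<in>A. g i a * x u a)\<^sup>2 = l i * (\<Sum>a\<in>A. w i a * x u a)\<^sup>2" for u
      using nonneg[OF that] by (simp only: power_mult_distrib real_sqrt_pow2)
    then show ?thesis
      by (simp only: b_def sum_distrib_left[symmetric])
  qed
  define J where "J = {i. i < n \<and> l i \<noteq> 0}"
  have "finite J" by (simp add: J_def)
  have orth_w: "(\<Sum>a\<in>A. w i a * w j a) = (if i = j then 1 else 0)" if "i \<in> J" "j \<in> J" for i j
  proof (cases "i = j")
    case True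
    then show ?thesis using that norm_w[of i] by (simp add: J_def power2_eq_square)
  next
    case False
    then show ?thesis using that g[of i j] by (simp add: J_def w_def flip: sum_divide_distrib)
  qed
  have "(\<Sum>i<n. b i) = (\<Sum>i\<in>J. b i)"
  proof (rule sum.mono_neutral_right)
    show "\<forall>i\<in>{..<n} - J. b i = 0"
      by (simp add: J_def b_def w_def)
  qed (auto simp: J_def)
  also have "\<dots> = (\<Sum>u\<in>U. \<Sum>i\<in>J. (\<Sum>a\<in>A. x u a * w i a)\<^sup>2)"
    unfolding b_def by (subst sum.swap) (simp add: mult.commute)
  also have "\<dots> \<le> (\<Sum>u\<in>U. \<Sum>a\<in>A. (x u a)\<^sup>2)"
    by (intro sum_mono bessel_inequality_finite \<open>finite J\<close> orth_w)
  also have "\<dots> = real (card U)"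
    using x by (simp add: power2_eq_square)
  finally have total: "(\<Sum>i<n. b i) \<le> real (card U)" .
  have "(\<Sum>u\<in>U. \<Sum>i<n. (\<Sum>a\<in>A. g i a * x u a)\<^sup>2) = (\<Sum>i<n. l i * b i)"
    by (subst sum.swap) (simp add: scale)
  also have "\<dots> \<le> (\<Sum>i<card U. l i)"
  proof (rule weighted_sum_le_sum_of_largest[OF \<open>card U < n\<close> mono nonneg _ _ total])
    show "0 \<le> b i" for i by (simp add: b_def sum_nonneg)
    show "b i \<le> 1" if "i < n" for i
      using b_le[of i] norm_w[OF that] by (simp split: if_splits)
  qed auto
  finally show ?thesis .
qed

section \<open>The spectral theorem for real symmetric matrices\<close>

text \<open>A complex eigenvalue \<open>\<mu>\<close> exists. If \<open>w\<close> is an eigenvector for it, then the number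
  \<open>w\<^sup>* A w = \<mu> |w|\<^sup>2\<close> is its own conjugate by symmetry, so \<open>\<mu>\<close> is real. Being a real root of the
  characteristic polynomial, it is an eigenvalue of the real matrix too.\<close>

lemma symmetric_real_mat_has_eigenvalue:
  fixes A :: "real mat"
  assumes A: "A \<in> carrier_mat n n" and sym: "transpose_mat A = A" and "n \<noteq> 0"
  shows "\<exists>e. eigenvalue A e"
proof -
  define B where "B = map_mat complex_of_real A"
  have B: "B \<in> carrier_mat n n" using A by (simp add: B_def)
  obtain \<mu> w where "eigenvector B w \<mu>"
    using spectrum_non_empty[OF B] \<open>n \<noteq> 0\<close> unfolding spectrum_def eigenvalue_def by auto
  then have w: "w \<in> carrier_vec n" "w \<noteq> 0\<^sub>v n" and Bw: "B *\<^sub>v w = \<mu> \<cdot>\<^sub>v w"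
    using B by (auto simp: eigenvector_def)
  have entry: "(\<Sum>j<n. of_real (A $$ (i, j)) * w $ j) = \<mu> * w $ i" if "i < n" for i
    using arg_cong[OF Bw, of "\<lambda>v. v $ i"] that w(1) A
    by (simp add: B_def scalar_prod_def atLeast0LessThan)
  have A_sym: "A $$ (i, j) = A $$ (j, i)" if "i < n" "j < n" for i j
    using arg_cong[OF sym, of "\<lambda>M. M $$ (i, j)"] that A by simp
  define q where "q = (\<Sum>i<n. \<Sum>j<n. cnj (w $ i) * of_real (A $$ (i, j)) * w $ j)"
  have "cnj q = (\<Sum>i<n. \<Sum>j<n. w $ i * of_real (A $$ (i, j)) * cnj (w $ j))"
    by (simp add: q_def)
  also have "\<dots> = (\<Sum>j<n. \<Sum>i<n. w $ i * of_real (A $$ (i, j)) * cnj (w $ j))"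
    by (rule sum.swap)
  also have "\<dots> = q"
    unfolding q_def by (intro sum.cong refl) (simp add: A_sym)
  finally have "cnj q = q" .
  have "q = (\<Sum>i<n. cnj (w $ i) * (\<mu> * w $ i))"
    by (simp add: q_def entry mult.assoc flip: sum_distrib_left)
  also have "\<dots> = \<mu> * of_real (\<Sum>i<n. (cmod (w $ i))\<^sup>2)"
    by (simp add: sum_distrib_left complex_norm_square algebra_simps flip: of_real_power)
  finally have q: "q = \<mu> * of_real (\<Sum>i<n. (cmod (w $ i))\<^sup>2)" (is "_ = _ * of_real ?N") .
  obtain k where "k < n" "w $ k \<noteq> 0"
    using w by (metis eq_vecI carrier_vecD index_zero_vec)
  then have "(\<Sum>i<n. (cmod (w $ i))\<^sup>2) \<noteq> 0"
    by (subst sum_nonneg_eq_0_iff) auto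
  then have "cnj \<mu> = \<mu>"
    using \<open>cnj q = q\<close> unfolding q complex_cnj_mult complex_cnj_complex_of_real
    by (metis mult_right_cancel of_real_eq_0_iff)
  then obtain e where e: "\<mu> = of_real e"
    by (metis Reals_cnj_iff Reals_cases)
  have "poly (char_poly B) \<mu> = 0"
    using \<open>eigenvector B w \<mu>\<close> eigenvalue_root_char_poly[OF B] by (auto simp: eigenvalue_def)
  then have "poly (char_poly A) e = 0"
    by (simp add: B_def e of_real_hom.char_poly_hom[OF A])
  then show ?thesis using eigenvalue_root_char_poly[OF A] by blast
qed

text \<open>Complete \<open>v\<close> to a basis, apply the Gram-Schmidt process, which keeps the first vector,
  and normalise.\<close>

lemma orthogonal_mat_extending_vec:
  fixes v :: "real vec"
  assumes v: "v \<in> carrier_vec n" "v \<noteq> 0\<^sub>v n"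
  shows "\<exists>W\<in>carrier_mat n n. transpose_mat W * W = 1\<^sub>m n \<and> (\<exists>c. col W 0 = c \<cdot>\<^sub>v v)"
proof -
  interpret cof_vec_space n "TYPE(real)" .
  define b where "b = basis_completion v"
  define ws where "ws = gram_schmidt n b"
  have b: "set b \<subseteq> carrier_vec n" "distinct b" "\<not> lin_dep (set b)" "length b = n" "hd b = v"
    using basis_completion[OF v] by (auto simp: b_def)
  have "n \<noteq> 0" using v by auto
  then obtain vs where "b = v # vs" using b by (cases b) auto
  then have "hd ws = v" using gram_schmidt_hd[OF v(1), of vs] by (simp add: ws_def)
  have ws: "set ws \<subseteq> carrier_vec n" "corthogonal ws" "length ws = n"
    using gram_schmidt_result[OF b(1,2,3) refl] b(4) by (auto simp: ws_def)
  then have ws0: "ws ! 0 = v" using \<open>hd ws = v\<close> \<open>n \<noteq> 0\<close> by (metis hd_conv_nth list.size(3))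
  have ws_dim: "ws ! i \<in> carrier_vec n" if "i < n" for i using ws that by auto
  have conj: "conjugate x = x" for x :: "real vec" by (rule eq_vecI) auto
  have orth: "ws ! i \<bullet> ws ! j = 0 \<longleftrightarrow> i \<noteq> j" if "i < n" "j < n" for i j
    using corthogonalD[OF ws(2)] that ws(3) by (simp add: conj)
  have pos: "ws ! i \<bullet> ws ! i > 0" if "i < n" for i
  proof -
    have "ws ! i \<bullet> ws ! i \<ge> 0" by (simp add: scalar_prod_def sum_nonneg)
    then show ?thesis using orth[OF that that] by simp
  qed
  define s where "s i = 1 / sqrt (ws ! i \<bullet> ws ! i)" for i
  define W where "W = mat_of_cols n (map (\<lambda>i. s i \<cdot>\<^sub>v ws ! i) [0..<n])"
  have W: "W \<in> carrier_mat n n" by (simp add: W_def mat_of_cols_def)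
  have col_W: "col W i = s i \<cdot>\<^sub>v ws ! i" if "i < n" for i
    using that ws_dim[OF that] by (simp add: W_def)
  have "transpose_mat W * W = 1\<^sub>m n"
  proof (rule eq_matI)
    fix i j assume ij: "i < dim_row (1\<^sub>m n :: real mat)" "j < dim_col (1\<^sub>m n :: real mat)"
    then have "(transpose_mat W * W) $$ (i, j) = s i * s j * (ws ! i \<bullet> ws ! j)"
      using W ws_dim[of i] ws_dim[of j] by (simp add: col_W)
    also have "\<dots> = (1\<^sub>m n) $$ (i, j)"
      using ij orth[of i j] pos[of i] by (auto simp: s_def real_div_sqrt field_simps)
    finally show "(transpose_mat W * W) $$ (i, j) = (1\<^sub>m n) $$ (i, j)" .
  qed (use W in auto)
  moreover have "col W 0 = s 0 \<cdot>\<^sub>v v" using col_W[of 0] \<open>n \<noteq> 0\<close> ws0 by simp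
  ultimately show ?thesis using W by blast
qed

text \<open>Induction on the dimension. Conjugation with an orthogonal matrix whose first column is an
  eigenvector makes the first column of \<open>A\<close> a multiple of a unit vector; by symmetry the first row
  is one as well, and the remaining block is again symmetric.\<close>

lemma symmetric_real_mat_diagonalizable:
  fixes A :: "real mat"
  assumes "A \<in> carrier_mat n n" and "transpose_mat A = A"
  shows "\<exists>P\<in>carrier_mat n n. \<exists>es. length es = n \<and> transpose_mat P * P = 1\<^sub>m n \<and>
    transpose_mat P * A * P = mat n n (\<lambda>(i, j). if i = j then es ! i else 0)"
  using assms
proof (induction n arbitrary: A)
  case 0
  then show ?case by (intro bexI[of _ "1\<^sub>m 0"]) auto
next
  case (Suc k)
  note A = Suc.prems(1) and sym = Suc.prems(2)
  obtain e v where "eigenvector A v e"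
    using symmetric_real_mat_has_eigenvalue[OF A sym] by (auto simp: eigenvalue_def)
  then have v: "v \<in> carrier_vec (Suc k)" "v \<noteq> 0\<^sub>v (Suc k)" and Av: "A *\<^sub>v v = e \<cdot>\<^sub>v v"
    using A by (auto simp: eigenvector_def)
  obtain W c where W: "W \<in> carrier_mat (Suc k) (Suc k)"
    and WW: "transpose_mat W * W = 1\<^sub>m (Suc k)" and W0: "col W 0 = c \<cdot>\<^sub>v v"
    using orthogonal_mat_extending_vec[OF v] by blast
  have Wt: "transpose_mat W \<in> carrier_mat (Suc k) (Suc k)" using W by simp
  define B where "B = transpose_mat W * (A * W)"
  have B: "B \<in> carrier_mat (Suc k) (Suc k)" using A W by (simp add: B_def)
  have "transpose_mat B = transpose_mat (A * W) * W"
    unfolding B_def using transpose_mult[OF Wt, of "A * W" "Suc k"] A W by simp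
  also have "\<dots> = (transpose_mat W * A) * W"
    using transpose_mult[OF A W] sym by simp
  also have "\<dots> = B" unfolding B_def by (rule assoc_mult_mat[OF Wt A W])
  finally have B_sym: "B $$ (i, j) = B $$ (j, i)" if "i < Suc k" "j < Suc k" for i j
    using that B by (metis carrier_matD index_transpose_mat(1))
  have B_col: "B $$ (i, 0) = (if i = 0 then e else 0)" if "i < Suc k" for i
  proof -
    have "col (A * W) 0 = A *\<^sub>v col W 0" by (rule eq_vecI) (use A W in auto)
    also have "\<dots> = e \<cdot>\<^sub>v col W 0"
      using A v by (simp add: W0 Av mult_mat_vec smult_smult_assoc mult.commute)
    finally have "B $$ (i, 0) = e * (col W i \<bullet> col W 0)"
      using that A W by (simp add: B_def)
    also have "col W i \<bullet> col W 0 = (transpose_mat W * W) $$ (i, 0)" using that W by simp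
    finally show ?thesis using that by (simp add: WW)
  qed
  define C where "C = mat k k (\<lambda>(i, j). B $$ (Suc i, Suc j))"
  have C: "C \<in> carrier_mat k k" by (simp add: C_def)
  have C_sym: "transpose_mat C = C"
    using B_sym by (intro eq_matI) (auto simp: C_def)
  have B_block: "B = four_block_mat (mat 1 1 (\<lambda>_. e)) (0\<^sub>m 1 k) (0\<^sub>m k 1) C"
  proof (rule eq_matI)
    fix i j
    assume "i < dim_row (four_block_mat (mat 1 1 (\<lambda>_. e)) (0\<^sub>m 1 k) (0\<^sub>m k 1) C)"
      "j < dim_col (four_block_mat (mat 1 1 (\<lambda>_. e)) (0\<^sub>m 1 k) (0\<^sub>m k 1) C)"
    then have "i < Suc k" "j < Suc k" by (simp_all add: C_def)
    then show "B $$ (i, j) = four_block_mat (mat 1 1 (\<lambda>_. e)) (0\<^sub>m 1 k) (0\<^sub>m k 1) C $$ (i, j)"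
      using B_col[of i] B_col[of j] B_sym[of 0 j] by (cases i; cases j) (auto simp: C_def)
  qed (use B in \<open>auto simp: C_def\<close>)
  obtain Q es where Q: "Q \<in> carrier_mat k k" and es: "length es = k"
    and QQ: "transpose_mat Q * Q = 1\<^sub>m k"
    and QCQ: "transpose_mat Q * C * Q = mat k k (\<lambda>(i, j). if i = j then es ! i else 0)"
    using Suc.IH[OF C C_sym] by blast
  define F where "F = four_block_mat (1\<^sub>m 1) (0\<^sub>m 1 k) (0\<^sub>m k 1) Q"
  have F: "F \<in> carrier_mat (Suc k) (Suc k)"
    unfolding F_def using four_block_carrier_mat[of "1\<^sub>m 1" 1 1 Q k k] Q by simp
  have Ft: "transpose_mat F = four_block_mat (1\<^sub>m 1) (0\<^sub>m 1 k) (0\<^sub>m k 1) (transpose_mat Q)"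
    unfolding F_def by (subst transpose_four_block_mat[of _ 1 1 _ k _ k]) (use Q in auto)
  have FF: "transpose_mat F * F = 1\<^sub>m (Suc k)"
    unfolding Ft unfolding F_def
    by (subst mult_four_block_mat[of _ 1 1 _ k _ k _ _ 1 _ k]) (use Q QQ in auto)
  have FBF: "transpose_mat F * B * F = mat (Suc k) (Suc k) (\<lambda>(i, j). if i = j then (e # es) ! i else 0)"
  proof -
    have "transpose_mat F * B
      = four_block_mat (mat 1 1 (\<lambda>_. e)) (0\<^sub>m 1 k) (0\<^sub>m k 1) (transpose_mat Q * C)"
      unfolding Ft B_block
      by (subst mult_four_block_mat[of _ 1 1 _ k _ k _ _ 1 _ k]) (use Q C in auto)
    also have "\<dots> * F
      = four_block_mat (mat 1 1 (\<lambda>_. e)) (0\<^sub>m 1 k) (0\<^sub>m k 1) (transpose_mat Q * C * Q)"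
      unfolding F_def
      by (subst mult_four_block_mat[of _ 1 1 _ k _ k _ _ 1 _ k]) (use Q C in auto)
    also have "\<dots> = mat (Suc k) (Suc k) (\<lambda>(i, j). if i = j then (e # es) ! i else 0)"
      unfolding QCQ by (rule eq_matI) (auto simp: nth_Cons')
    finally show ?thesis .
  qed
  have Ft': "transpose_mat F \<in> carrier_mat (Suc k) (Suc k)" using F by simp
  have tWF: "transpose_mat (W * F) = transpose_mat F * transpose_mat W"
    by (rule transpose_mult[OF W F])
  have "transpose_mat (W * F) * (W * F) = transpose_mat F * (transpose_mat W * W) * F"
    unfolding tWF using Ft' Wt W F
    by (smt (verit) assoc_mult_mat mult_carrier_mat)
  then have "transpose_mat (W * F) * (W * F) = 1\<^sub>m (Suc k)" using WW FF F by simp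
  moreover have "transpose_mat (W * F) * A * (W * F) = transpose_mat F * B * F"
    unfolding tWF B_def using Ft' Wt W F A
    by (smt (verit) assoc_mult_mat mult_carrier_mat)
  ultimately show ?case
    using W F FBF es by (intro bexI[of _ "W * F"] exI[of _ "e # es"]) auto
qed

text \<open>The vectors \<open>v i\<close> are the columns of the orthogonal matrix that diagonalises \<open>A\<close>, in the order
  of the sorted eigenvalues. The two orthogonality relations say that these columns, respectively
  the rows, are orthonormal; the second one yields the identity of Parseval.\<close>

lemma symmetric_real_mat_orthonormal_eigenbasis:
  fixes A :: "real mat"
  assumes A: "A \<in> carrier_mat n n" and sym: "transpose_mat A = A"
  defines "ls \<equiv> rev (sorted_list_of_multiset (proots (char_poly A)))"
  shows "length ls = n"
    and "\<exists>v. (\<forall>i<n. \<forall>j<n. (\<Sum>x<n. v i x * v j x) = (if i = j then 1 else 0))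
      \<and> (\<forall>x<n. \<forall>y<n. (\<Sum>i<n. v i x * v i y) = (if x = y then 1 else 0))
      \<and> (\<forall>i<n. \<forall>x<n. (\<Sum>y<n. A $$ (x, y) * v i y) = ls ! i * v i x)"
proof -
  obtain P es where P: "P \<in> carrier_mat n n" and es: "length es = n"
    and PP: "transpose_mat P * P = 1\<^sub>m n"
    and PAP: "transpose_mat P * A * P = mat n n (\<lambda>(i, j). if i = j then es ! i else 0)"
    using symmetric_real_mat_diagonalizable[OF A sym] by blast
  define D where "D = mat n n (\<lambda>(i, j). if i = j then es ! i else 0)"
  have D: "D \<in> carrier_mat n n" by (simp add: D_def)
  have Pt: "transpose_mat P \<in> carrier_mat n n" using P by simp
  have PPt: "P * transpose_mat P = 1\<^sub>m n" by (rule mat_mult_left_right_inverse[OF Pt P PP])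
  have "P * D = (P * transpose_mat P) * (A * P)"
    unfolding D_def PAP[symmetric] using P Pt A by (smt (verit) assoc_mult_mat mult_carrier_mat)
  then have AP: "A * P = P * D" using A P PPt by simp
  have "A = A * (P * transpose_mat P)" using A PPt by simp
  also have "\<dots> = P * D * transpose_mat P"
    using assoc_mult_mat[OF A P Pt] AP by simp
  finally have "similar_mat A D"
    using A D P Pt PP PPt by (intro similar_matI[of _ _ P "transpose_mat P" n]) auto
  then have "char_poly A = char_poly D" by (rule char_poly_similar)
  also have "\<dots> = (\<Prod>a\<leftarrow>diag_mat D. [:- a, 1:])"
    by (rule char_poly_upper_triangular[OF D]) (auto simp: D_def)
  also have "diag_mat D = es"
    using es by (intro nth_equalityI) (auto simp: diag_mat_def D_def)
  finally have cp: "char_poly A = (\<Prod>a\<leftarrow>es. [:- a, 1:])" .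
  have "proots (\<Prod>a\<leftarrow>xs. [:- a, 1:]) = mset xs" for xs :: "real list"
  proof (induction xs)
    case (Cons a xs)
    have "(\<Prod>a\<leftarrow>xs. [:- a, 1:]) \<noteq> 0" by (simp add: prod_list_zero_iff) auto
    then have "proots ([:- a, 1:] * (\<Prod>a\<leftarrow>xs. [:- a, 1:])) = {#a#} + proots (\<Prod>a\<leftarrow>xs. [:- a, 1:])"
      by (subst proots_mult) simp_all
    then show ?case using Cons.IH by simp
  qed simp
  then have mset_ls: "mset ls = mset es" by (simp add: ls_def cp)
  then show len: "length ls = n" using es mset_eq_length by metis
  \<comment> \<open>The diagonal entries \<open>es\<close> come in no particular order; \<open>p\<close> sorts them.\<close>
  obtain p where p: "p permutes {..<length es}" "permute_list p es = ls"
    using mset_eq_permutation[OF mset_ls] .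
  have ls_nth: "ls ! i = es ! p i" if "i < n" for i
    using p that es permute_list_nth by metis
  have p_lt: "p i < n" if "i < n" for i
    using p(1) that es permutes_in_image[of p "{..<n}" i] by simp
  have p_inj: "p i = p j \<longleftrightarrow> i = j" for i j
    using permutes_inj[OF p(1)] by (auto dest: injD)
  define v where "v i x = P $$ (x, p i)" for i x
  have "(\<Sum>x<n. v i x * v j x) = (if i = j then 1 else 0)" if "i < n" "j < n" for i j
    using arg_cong[OF PP, of "\<lambda>M. M $$ (p i, p j)"] that p_lt[of i] p_lt[of j] P
    by (simp add: v_def scalar_prod_def atLeast0LessThan p_inj)
  moreover have "(\<Sum>i<n. v i x * v i y) = (if x = y then 1 else 0)" if "x < n" "y < n" for x y
  proof -
    have "(\<Sum>i<n. v i x * v i y) = (\<Sum>i<n. P $$ (x, i) * P $$ (y, i))"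
      unfolding v_def by (rule sum.permute[symmetric, unfolded o_def]) (use p(1) es in simp)
    then show ?thesis
      using arg_cong[OF PPt, of "\<lambda>M. M $$ (x, y)"] that P
      by (simp add: scalar_prod_def atLeast0LessThan)
  qed
  moreover have "(\<Sum>y<n. A $$ (x, y) * v i y) = ls ! i * v i x" if "i < n" "x < n" for i x
  proof -
    have "(\<Sum>y<n. A $$ (x, y) * v i y) = (A * P) $$ (x, p i)"
      using that p_lt[of i] A P by (simp add: v_def scalar_prod_def atLeast0LessThan)
    also have "\<dots> = (\<Sum>y<n. P $$ (x, y) * (if y = p i then es ! y else 0))"
      using that p_lt[of i] P unfolding AP
      by (simp add: D_def scalar_prod_def atLeast0LessThan)
    also have "\<dots> = ls ! i * v i x"
      using that p_lt[of i] by (simp add: if_distrib ls_nth v_def cong: if_cong)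
    finally show ?thesis .
  qed
  ultimately show "\<exists>v. (\<forall>i<n. \<forall>j<n. (\<Sum>x<n. v i x * v j x) = (if i = j then 1 else 0))
      \<and> (\<forall>x<n. \<forall>y<n. (\<Sum>i<n. v i x * v i y) = (if x = y then 1 else 0))
      \<and> (\<forall>i<n. \<forall>x<n. (\<Sum>y<n. A $$ (x, y) * v i y) = ls ! i * v i x)"
    by (intro exI[of _ v]) simp
qed

section \<open>Orientations of graphs\<close>

text \<open>Induction on \<open>U\<close>. Connectivity provides an edge from some \<open>u \<in> U\<close> to a vertex outside \<open>U\<close>.
  Start from an orientation for \<open>U - {u}\<close> and let all edges between \<open>u\<close> and the complement of \<open>U\<close>
  point away from \<open>u\<close>. The edges that get reversed have no endpoint in \<open>U - {u}\<close>, so the vertices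
  of this set keep their outgoing edges.\<close>

lemma exists_orientation_out_of:
  fixes V :: "'a set" and E :: "('a \<times> 'a) set"
  assumes "finite V" "E \<subseteq> V \<times> V" "sym E" "irrefl E"
    and connected: "\<forall>S\<subseteq>V. S \<noteq> {} \<longrightarrow> S \<noteq> V \<longrightarrow> (\<exists>x\<in>S. \<exists>y\<in>V - S. (x, y) \<in> E)"
    and "U \<subseteq> V" "U \<noteq> V"
  shows "\<exists>A\<subseteq>E. (\<forall>x y. (x, y) \<in> E \<longrightarrow> ((x, y) \<in> A \<longleftrightarrow> (y, x) \<notin> A))
    \<and> (\<forall>x y. (x, y) \<in> A \<longrightarrow> y \<in> U \<longrightarrow> x \<in> U) \<and> (\<forall>u\<in>U. \<exists>y. (u, y) \<in> A)"
proof -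
  have "finite U" using \<open>finite V\<close> \<open>U \<subseteq> V\<close> by (rule rev_finite_subset)
  then show ?thesis
    using \<open>U \<subseteq> V\<close> \<open>U \<noteq> V\<close>
  proof (induction U rule: finite_psubset_induct)
    case (psubset U)
    show ?case
    proof (cases "U = {}")
      case True
      obtain r :: "'a \<Rightarrow> nat" where r: "inj_on r V"
        using finite_imp_inj_to_nat_seg[OF \<open>finite V\<close>] by blast
      have ne: "r x \<noteq> r y" if "(x, y) \<in> E" for x y
        using that r \<open>E \<subseteq> V \<times> V\<close> \<open>irrefl E\<close> by (auto simp: inj_on_def irrefl_def)
      define A where "A = {(x, y) \<in> E. r x < r y}"
      have "(x, y) \<in> A \<longleftrightarrow> (y, x) \<notin> A" if "(x, y) \<in> E" for x y
        using ne[OF that] that symD[OF \<open>sym E\<close> that] by (auto simp: A_def)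
      moreover have "A \<subseteq> E" by (auto simp: A_def)
      ultimately show ?thesis using True by (intro exI[of _ A]) simp
    next
      case False
      with connected psubset.prems obtain u w
        where u: "u \<in> U" "w \<in> V - U" "(u, w) \<in> E" by blast
      have "U - {u} \<subset> U" "U - {u} \<subseteq> V" "U - {u} \<noteq> V" using u psubset.prems by auto
      from psubset.IH[OF this] obtain A where A: "A \<subseteq> E"
        "\<forall>x y. (x, y) \<in> E \<longrightarrow> ((x, y) \<in> A \<longleftrightarrow> (y, x) \<notin> A)"
        "\<forall>x y. (x, y) \<in> A \<longrightarrow> y \<in> U - {u} \<longrightarrow> x \<in> U - {u}"
        "\<forall>v\<in>U - {u}. \<exists>y. (v, y) \<in> A" by (elim exE conjE)
      define B where "B = {(x, y) \<in> A. \<not> (x \<notin> U \<and> y = u)} \<union> {(x, y) \<in> E. x = u \<and> y \<notin> U}"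
      have "B \<subseteq> E" using A(1) by (auto simp: B_def)
      moreover have "(x, y) \<in> B \<longleftrightarrow> (y, x) \<notin> B" if "(x, y) \<in> E" for x y
      proof -
        have "(v, w) \<in> B \<longleftrightarrow> (v, w) \<in> A \<and> \<not> (v \<notin> U \<and> w = u) \<or> v = u \<and> w \<notin> U"
          if "(v, w) \<in> E" for v w
          using that by (simp add: B_def)
        from this[OF that] this[OF symD[OF \<open>sym E\<close> that]] show ?thesis
          using A(2)[rule_format, OF that] \<open>u \<in> U\<close> by metis
      qed
      moreover have "x \<in> U" if "(x, y) \<in> B" "y \<in> U" for x y
        using that A(3)[rule_format, of x y] u(1) unfolding B_def by blast
      moreover have "\<exists>y. (v, y) \<in> B" if "v \<in> U" for v
        using that A(4)[rule_format, of v] u unfolding B_def by (cases "v = u") blast+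
      ultimately show ?thesis by (intro exI[of _ B] conjI allI impI ballI) simp_all
    qed
  qed
qed

lemma sum_over_orientation:
  fixes h :: "'a \<times> 'a \<Rightarrow> real"
  assumes "finite E" "sym E" "A \<subseteq> E" and orient: "\<And>x y. (x, y) \<in> E \<Longrightarrow> (x, y) \<in> A \<longleftrightarrow> (y, x) \<notin> A"
  shows "(\<Sum>p\<in>E. h p) = (\<Sum>(x, y)\<in>A. h (x, y) + h (y, x))"
proof -
  have swap: "(x, y) \<in> prod.swap ` A \<longleftrightarrow> (y, x) \<in> A" for x y by force
  have "(x, y) \<in> E \<longleftrightarrow> (x, y) \<in> A \<or> (y, x) \<in> A" for x y
    using orient[of x y] \<open>A \<subseteq> E\<close> symD[OF \<open>sym E\<close>] by blast
  then have E: "E = A \<union> prod.swap ` A" by (simp add: set_eq_iff split_paired_all swap)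
  have asym: "(y, x) \<notin> A" if "(x, y) \<in> A" for x y
    using orient[of x y] that \<open>A \<subseteq> E\<close> by blast
  then have "A \<inter> prod.swap ` A = {}" by auto
  moreover have "finite A" using assms finite_subset by blast
  ultimately have "(\<Sum>p\<in>E. h p) = (\<Sum>p\<in>A. h p) + (\<Sum>p\<in>A. h (prod.swap p))"
    unfolding E by (subst sum.union_disjoint) (auto simp: sum.reindex)
  then show ?thesis by (simp add: case_prod_unfold sum.distrib prod.swap_def)
qed

lemma (in graph) out_degree_eq_card_neighbours:
  "out_degree G u = card {v. u \<rightarrow>\<^bsub>G\<^esub> v}"
proof -
  have "bij_betw (head G) (out_arcs G u) {v. u \<rightarrow>\<^bsub>G\<^esub> v}"
    unfolding bij_betw_def
  proof
    show "inj_on (head G) (out_arcs G u)"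
      by (intro inj_onI no_multi_arcs) (auto simp: arc_to_ends_def)
    show "head G ` out_arcs G u = {v. u \<rightarrow>\<^bsub>G\<^esub> v}"
      by (auto simp: arcs_ends_conv image_iff)
  qed
  then show ?thesis unfolding out_degree_def by (rule bij_betw_same_card)
qed

lemma (in graph) connected_cut_edge:
  assumes "connected G" "S \<subseteq> verts G" "S \<noteq> {}" "S \<noteq> verts G"
  shows "\<exists>x\<in>S. \<exists>y\<in>verts G - S. x \<rightarrow>\<^bsub>G\<^esub> y"
proof (rule ccontr)
  assume no_edge: "\<not> ?thesis"
  obtain a b where "a \<in> S" "b \<in> verts G - S" using assms by auto
  then have "a \<rightarrow>\<^sup>*\<^bsub>G\<^esub> b"
    using symmetric_connected_imp_strongly_connected[OF sym_arcs \<open>connected G\<close>] \<open>S \<subseteq> verts G\<close>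
    by (auto simp: strongly_connected_def)
  then have "b \<in> S"
  proof (induction rule: reachable_induct)
    case base
    show ?case by fact
  next
    case (step x y)
    then show ?case using no_edge adj_in_verts by blast
  qed
  then show False using \<open>b \<in> verts G - S\<close> by simp
qed

lemma (in graph) sum_adjacent_pairs:
  "(\<Sum>x\<in>verts G. \<Sum>y | x \<rightarrow>\<^bsub>G\<^esub> y. h x y) = (\<Sum>(x, y)\<in>arcs_ends G. h x y)" for h :: "'a \<Rightarrow> 'a \<Rightarrow> real"
proof -
  have "finite {y. x \<rightarrow>\<^bsub>G\<^esub> y}" for x
    by (rule finite_subset[of _ "verts G"]) (use adj_in_verts in auto)
  moreover have "arcs_ends G = (SIGMA x:verts G. {y. x \<rightarrow>\<^bsub>G\<^esub> y})"
    using adj_in_verts by auto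
  ultimately show ?thesis by (simp add: sum.Sigma)
qed

text \<open>Each edge with an endpoint in \<open>U\<close> leaves a vertex of \<open>U\<close>, and leaves only one vertex. The
  degree sum counts in addition the edges that enter a vertex of \<open>U\<close>, and these are the edges
  inside \<open>U\<close>.\<close>

lemma (in graph) sum_out_degree_orientation:
  assumes A: "A \<subseteq> arcs_ends G"
    and orient: "\<And>x y. x \<rightarrow>\<^bsub>G\<^esub> y \<Longrightarrow> (x, y) \<in> A \<longleftrightarrow> (y, x) \<notin> A"
    and out: "\<And>x y. (x, y) \<in> A \<Longrightarrow> y \<in> U \<Longrightarrow> x \<in> U" and "U \<subseteq> verts G"
  shows "(\<Sum>u\<in>U. card {y. (u, y) \<in> A}) + card (edges_within G U) = (\<Sum>u\<in>U. out_degree G u)"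
proof -
  have fin: "finite {y. u \<rightarrow>\<^bsub>G\<^esub> y}" for u
    by (rule finite_subset[of _ "verts G"]) (use adj_in_verts in auto)
  have "finite U" using \<open>U \<subseteq> verts G\<close> finite_verts finite_subset by blast
  have adj_sym: "y \<rightarrow>\<^bsub>G\<^esub> x" if "x \<rightarrow>\<^bsub>G\<^esub> y" for x y
    using arcs_ends_symmetric[OF sym_arcs that] .
  have asym: "(y, x) \<notin> A" if "(x, y) \<in> A" for x y
    using orient[of x y] that A by blast
  have "out_degree G u = card {y. (u, y) \<in> A} + card {y. (y, u) \<in> A}" for u
  proof -
    have "{y. u \<rightarrow>\<^bsub>G\<^esub> y} = {y. (u, y) \<in> A} \<union> {y. (y, u) \<in> A}"
      using A orient[of u] adj_sym by blast
    moreover have "{y. (u, y) \<in> A} \<inter> {y. (y, u) \<in> A} = {}"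
      using asym by blast
    ultimately show ?thesis
      using fin[of u] by (simp add: out_degree_eq_card_neighbours card_Un_disjoint)
  qed
  moreover have "card (edges_within G U) = (\<Sum>u\<in>U. card {y. (y, u) \<in> A})"
  proof -
    define T where "T = (SIGMA u:U. {y. (y, u) \<in> A})"
    have "bij_betw (\<lambda>(u, y). {u, y}) T (edges_within G U)"
      unfolding bij_betw_def
    proof
      show "inj_on (\<lambda>(u, y). {u, y}) T"
        using asym by (auto simp: inj_on_def T_def doubleton_eq_iff)
      show "(\<lambda>(u, y). {u, y}) ` T = edges_within G U"
      proof
        show "(\<lambda>(u, y). {u, y}) ` T \<subseteq> edges_within G U"
          using A out adj_sym by (fastforce simp: T_def edges_within_def uedges_def)
        show "edges_within G U \<subseteq> (\<lambda>(u, y). {u, y}) ` T"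
        proof
          fix e assume "e \<in> edges_within G U"
          then obtain u v where e: "e = {u, v}" "u \<rightarrow>\<^bsub>G\<^esub> v" "u \<in> U" "v \<in> U"
            by (auto simp: edges_within_def uedges_def)
          then have "(v, u) \<in> T \<or> (u, v) \<in> T" using orient[OF e(2)] by (auto simp: T_def)
          then show "e \<in> (\<lambda>(u, y). {u, y}) ` T"
            using e(1) by (force simp: insert_commute)
        qed
      qed
    qed
    then have "card (edges_within G U) = card T" using bij_betw_same_card by metis
    also have "\<dots> = (\<Sum>u\<in>U. card {y. (y, u) \<in> A})"
      unfolding T_def
    proof (rule card_SigmaI[OF \<open>finite U\<close>], rule ballI)
      fix u assume "u \<in> U"
      show "finite {y. (y, u) \<in> A}"
        by (rule finite_subset[OF _ fin[of u]]) (use A adj_sym in auto)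
    qed
    finally show ?thesis .
  qed
  ultimately show ?thesis by (simp add: sum.distrib)
qed

section \<open>Laplacian eigenvalues and stars\<close>

text \<open>The spectral theorem with the coordinates \<open>0, \<dots>, n - 1\<close> replaced by vertices, so that the
  enumeration \<open>vs\<close> occurs no longer in the properties of the eigenvectors. The eigenvalue equation
  uses that row \<open>x\<close> of the Laplacian applied to \<open>f\<close> is the sum of \<open>f x - f y\<close> over the neighbours
  \<open>y\<close> of \<open>x\<close>.\<close>

lemma (in graph) laplacian_orthonormal_eigenbasis:
  assumes "distinct vs" "set vs = verts G"
  defines "l \<equiv> laplacian_eigenvalues G vs" and "n \<equiv> card (verts G)"
  shows "length l = n"
    and "\<exists>f. (\<forall>i<n. \<forall>j<n. (\<Sum>x\<in>verts G. f i x * f j x) = (if i = j then 1 else 0))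
      \<and> (\<forall>x\<in>verts G. \<forall>y\<in>verts G. (\<Sum>i<n. f i x * f i y) = (if x = y then 1 else 0))
      \<and> (\<forall>i<n. \<forall>x\<in>verts G. (\<Sum>y | x \<rightarrow>\<^bsub>G\<^esub> y. f i x - f i y) = l ! i * f i x)"
proof -
  have len: "length vs = n" using assms distinct_card by metis
  let ?L = "laplacian_mat G vs"
  have L: "?L \<in> carrier_mat n n"
    by (intro carrier_matI) (simp_all add: laplacian_mat_def degree_mat_def adjacency_mat_def len)
  have L_entry: "?L $$ (x, y) = (if x = y then real (out_degree G (vs ! x)) else 0)
      - (if vs ! x \<rightarrow>\<^bsub>G\<^esub> vs ! y then 1 else 0)" if "x < n" "y < n" for x y
    using that by (simp add: laplacian_mat_def degree_mat_def adjacency_mat_def len)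
  have L_sym: "transpose_mat ?L = ?L"
    using L L_entry arcs_ends_symmetric[OF sym_arcs] by (intro eq_matI) auto
  note basis = symmetric_real_mat_orthonormal_eigenbasis[OF L L_sym, folded laplacian_eigenvalues_def l_def]
  show "length l = n" by (rule basis(1))
  obtain v where
    v1: "\<forall>i<n. \<forall>j<n. (\<Sum>x<n. v i x * v j x) = (if i = j then 1 else (0::real))" and
    v2: "\<forall>x<n. \<forall>y<n. (\<Sum>i<n. v i x * v i y) = (if x = y then 1 else 0)" and
    v3: "\<forall>i<n. \<forall>x<n. (\<Sum>y<n. ?L $$ (x, y) * v i y) = l ! i * v i x"
    using basis(2) by (elim exE conjE)
  have bij: "bij_betw ((!) vs) {..<n} (verts G)"
    using bij_betw_nth[OF \<open>distinct vs\<close>] len assms(2) by blast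
  define r where "r = the_inv_into {..<n} ((!) vs)"
  have r: "r (vs ! k) = k" if "k < n" for k
    unfolding r_def using that bij by (intro the_inv_into_f_f) (auto simp: bij_betw_def)
  have r_lt: "r x < n" and vs_r: "vs ! r x = x" if "x \<in> verts G" for x
  proof -
    obtain k where "k < n" "x = vs ! k"
      using \<open>x \<in> verts G\<close> bij by (auto simp: bij_betw_def)
    then show "r x < n" "vs ! r x = x" by (simp_all add: r)
  qed
  have sum_verts: "(\<Sum>x\<in>verts G. h x) = (\<Sum>k<n. h (vs ! k))" for h :: "'a \<Rightarrow> real"
    using sum.reindex_bij_betw[OF bij, of h] by simp
  define f where "f i x = v i (r x)" for i x
  have "(\<Sum>x\<in>verts G. f i x * f j x) = (if i = j then 1 else 0)" if "i < n" "j < n" for i j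
    using v1 that by (simp add: sum_verts f_def r)
  moreover have "(\<Sum>i<n. f i x * f i y) = (if x = y then 1 else 0)"
    if "x \<in> verts G" "y \<in> verts G" for x y
    using v2 r_lt vs_r that unfolding f_def by metis
  moreover have "(\<Sum>y | x \<rightarrow>\<^bsub>G\<^esub> y. f i x - f i y) = l ! i * f i x"
    if "i < n" "x \<in> verts G" for i x
  proof -
    have nbrs: "{y. x \<rightarrow>\<^bsub>G\<^esub> y} = {y \<in> verts G. x \<rightarrow>\<^bsub>G\<^esub> y}" using adj_in_verts by blast
    have "(\<Sum>y | x \<rightarrow>\<^bsub>G\<^esub> y. f i y) = (\<Sum>y\<in>verts G. if x \<rightarrow>\<^bsub>G\<^esub> y then f i y else 0)"
      unfolding nbrs by (simp add: sum.inter_filter)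
    also have "\<dots> = (\<Sum>k<n. (if x \<rightarrow>\<^bsub>G\<^esub> vs ! k then 1 else 0) * v i k)"
      unfolding sum_verts by (intro sum.cong refl) (simp add: f_def r)
    finally have "(\<Sum>y | x \<rightarrow>\<^bsub>G\<^esub> y. f i x - f i y)
      = real (out_degree G x) * v i (r x) - (\<Sum>k<n. (if x \<rightarrow>\<^bsub>G\<^esub> vs ! k then 1 else 0) * v i k)"
      by (simp add: sum_subtractf out_degree_eq_card_neighbours) (simp add: f_def)
    also have "\<dots> = (\<Sum>k<n. ?L $$ (r x, k) * v i k)"
      using r_lt[OF that(2)] vs_r[OF that(2)]
      by (simp add: L_entry left_diff_distrib sum_subtractf if_distrib[of "\<lambda>c. c * _"] cong: if_cong)
    also have "\<dots> = l ! i * f i x"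
      using v3 that r_lt[OF that(2)] by (simp add: f_def)
    finally show ?thesis .
  qed
  ultimately show "\<exists>f. (\<forall>i<n. \<forall>j<n. (\<Sum>x\<in>verts G. f i x * f j x) = (if i = j then 1 else 0))
      \<and> (\<forall>x\<in>verts G. \<forall>y\<in>verts G. (\<Sum>i<n. f i x * f i y) = (if x = y then 1 else 0))
      \<and> (\<forall>i<n. \<forall>x\<in>verts G. (\<Sum>y | x \<rightarrow>\<^bsub>G\<^esub> y. f i x - f i y) = l ! i * f i x)"
    by (intro exI[of _ f]) simp
qed

text \<open>The star of \<open>u\<close> consists of the arcs of \<open>A\<close> that leave \<open>u\<close>. In terms of the incidence matrix
  \<open>N\<close> of \<open>A\<close>, with \<open>+1\<close> at the tail and \<open>-1\<close> at the head of an arc, \<open>g i\<close> is \<open>N\<^sup>T (f i)\<close>,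
  \<open>star u\<close> is the normalised indicator vector of a star and \<open>boundary u\<close> is \<open>N (star u)\<close>. The inner
  products of the \<open>g i\<close> are values of the Laplacian form \<open>N N\<^sup>T\<close>, and the Parseval identity for the
  eigenbasis \<open>f\<close> shows that \<open>star u\<close> has the energy \<open>|boundary u|\<^sup>2\<close>, which is \<open>k u * (1 / k u) + k u\<close>.\<close>

lemma (in graph) sum_laplacian_eigenvalues_ge_stars:
  assumes vs: "distinct vs" "set vs = verts G"
    and A: "A \<subseteq> arcs_ends G"
    and orient: "\<And>x y. x \<rightarrow>\<^bsub>G\<^esub> y \<Longrightarrow> (x, y) \<in> A \<longleftrightarrow> (y, x) \<notin> A"
    and U: "U \<subseteq> verts G" "U \<noteq> verts G" and nonempty: "\<And>u. u \<in> U \<Longrightarrow> \<exists>y. (u, y) \<in> A"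
  shows "(\<Sum>u\<in>U. real (card {y. (u, y) \<in> A}) + 1) \<le> (\<Sum>i<card U. laplacian_eigenvalues G vs ! i)"
proof -
  define l where "l = laplacian_eigenvalues G vs"
  define n where "n = card (verts G)"
  note basis = laplacian_orthonormal_eigenbasis[OF vs, folded l_def n_def]
  obtain f where
    orthonormal: "\<forall>i<n. \<forall>j<n. (\<Sum>x\<in>verts G. f i x * f j x) = (if i = j then 1 else (0::real))" and
    complete: "\<forall>x\<in>verts G. \<forall>y\<in>verts G. (\<Sum>i<n. f i x * f i y) = (if x = y then 1 else 0)" and
    eigen: "\<forall>i<n. \<forall>x\<in>verts G. (\<Sum>y | x \<rightarrow>\<^bsub>G\<^esub> y. f i x - f i y) = l ! i * f i x"
    using basis(2) by (elim exE conjE)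
  have sym: "sym (arcs_ends G)" using sym_arcs by (simp add: symmetric_def)
  have fin_E: "finite (arcs_ends G)" by (simp add: arcs_ends_def)
  have fin_A: "finite A" using A fin_E finite_subset by blast
  have fin_U: "finite U" using U finite_verts finite_subset by blast
  define out where "out u = {y. (u, y) \<in> A}" for u
  have out_verts: "out u \<subseteq> verts G" for u using A adj_in_verts by (auto simp: out_def)
  have fin_out: "finite (out u)" for u using out_verts finite_verts finite_subset by blast
  have self: "u \<notin> out u" for u using A adj_not_same by (auto simp: out_def)
  define k where "k u = real (card (out u))" for u
  have k_pos: "k u > 0" if "u \<in> U" for u
    using nonempty[OF that] fin_out[of u] by (auto simp: k_def out_def card_gt_0_iff)
  define g where "g i p = f i (fst p) - f i (snd p)" for i and p :: "'a \<times> 'a"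
  define star where "star u p = (if fst p = u then 1 / sqrt (k u) else 0)" for u and p :: "'a \<times> 'a"
  define boundary where "boundary u x = (if x = u then sqrt (k u) else if x \<in> out u then - 1 / sqrt (k u) else 0)" for u x
  have sum_star: "(\<Sum>p\<in>A. h p * star u p) = (\<Sum>y\<in>out u. h (u, y)) / sqrt (k u)"
    for h :: "'a \<times> 'a \<Rightarrow> real" and u
  proof -
    have "(\<Sum>p\<in>A. h p * star u p) = (\<Sum>p\<in>A. if fst p = u then h p / sqrt (k u) else 0)"
      by (intro sum.cong) (auto simp: star_def)
    also have "\<dots> = (\<Sum>p | p \<in> A \<and> fst p = u. h p / sqrt (k u))"
      using fin_A by (simp add: sum.inter_filter)
    also have "{p. p \<in> A \<and> fst p = u} = Pair u ` out u" by (auto simp: out_def)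
    also have "(\<Sum>p\<in>Pair u ` out u. h p / sqrt (k u)) = (\<Sum>y\<in>out u. h (u, y) / sqrt (k u))"
      by (subst sum.reindex) (auto simp: inj_on_def)
    finally show ?thesis by (simp add: sum_divide_distrib)
  qed
  have gram: "(\<Sum>p\<in>A. g i p * g j p) = (if i = j then l ! i else 0)" if "i < n" "j < n" for i j
  proof -
    have "(\<Sum>p\<in>A. g i p * g j p) = (\<Sum>(x, y)\<in>arcs_ends G. f i x * (f j x - f j y))"
      by (subst sum_over_orientation[OF fin_E sym A orient])
         (auto simp: g_def algebra_simps intro!: sum.cong)
    also have "\<dots> = (\<Sum>x\<in>verts G. f i x * (\<Sum>y | x \<rightarrow>\<^bsub>G\<^esub> y. f j x - f j y))"
      by (simp add: sum_distrib_left flip: sum_adjacent_pairs)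
    also have "\<dots> = (\<Sum>x\<in>verts G. l ! j * (f i x * f j x))"
      using eigen that by (intro sum.cong) auto
    also have "\<dots> = (if i = j then l ! i else 0)"
      using orthonormal that by (simp flip: sum_distrib_left)
    finally show ?thesis .
  qed
  have star_orth: "(\<Sum>p\<in>A. star u p * star w p) = (if u = w then 1 else 0)" if "u \<in> U" "w \<in> U" for u w
    using k_pos[OF \<open>w \<in> U\<close>] unfolding sum_star by (simp add: star_def k_def flip: real_sqrt_mult)
  have sum_boundary: "(\<Sum>x\<in>verts G. h x * boundary u x) = sqrt (k u) * h u - (\<Sum>y\<in>out u. h y) / sqrt (k u)"
    if "u \<in> U" for h :: "'a \<Rightarrow> real" and u
  proof -
    have "(\<Sum>x\<in>verts G. h x * boundary u x)
        = (\<Sum>x\<in>verts G. (if x = u then sqrt (k u) * h u else 0) - (if x \<in> out u then h x / sqrt (k u) else 0))"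
      using self by (intro sum.cong) (auto simp: boundary_def)
    also have "\<dots> = sqrt (k u) * h u - (\<Sum>x\<in>verts G \<inter> out u. h x / sqrt (k u))"
      using that U by (auto simp: sum_subtractf sum.inter_restrict)
    also have "verts G \<inter> out u = out u" using out_verts by blast
    finally show ?thesis by (simp add: sum_divide_distrib)
  qed
  have project: "(\<Sum>p\<in>A. g i p * star u p) = (\<Sum>x\<in>verts G. f i x * boundary u x)" if "u \<in> U" for i u
    unfolding sum_star sum_boundary[OF that]
    using k_pos[OF that] by (simp add: g_def sum_subtractf field_simps k_def)
  have parseval: "(\<Sum>i<n. (\<Sum>x\<in>verts G. f i x * boundary u x)\<^sup>2) = (\<Sum>x\<in>verts G. boundary u x * boundary u x)" for u
  proof -
    have "(\<Sum>i<n. (\<Sum>x\<in>verts G. f i x * boundary u x)\<^sup>2)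
        = (\<Sum>i<n. \<Sum>x\<in>verts G. \<Sum>y\<in>verts G. boundary u x * boundary u y * (f i x * f i y))"
      by (simp add: power2_eq_square sum_product algebra_simps)
    also have "\<dots> = (\<Sum>x\<in>verts G. \<Sum>y\<in>verts G. \<Sum>i<n. boundary u x * boundary u y * (f i x * f i y))"
      by (subst sum.swap) (intro sum.cong refl sum.swap)
    also have "\<dots> = (\<Sum>x\<in>verts G. \<Sum>y\<in>verts G. if x = y then boundary u x * boundary u y else 0)"
      using complete by (intro sum.cong refl) (simp flip: sum_distrib_left)
    finally show ?thesis by simp
  qed
  have energy: "(\<Sum>i<n. (\<Sum>p\<in>A. g i p * star u p)\<^sup>2) = k u + 1" if "u \<in> U" for u
  proof -
    have "(\<Sum>y\<in>out u. boundary u y) = (\<Sum>y\<in>out u. - 1 / sqrt (k u))"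
      using self by (intro sum.cong) (auto simp: boundary_def)
    then have "(\<Sum>y\<in>out u. boundary u y) / sqrt (k u) = - 1"
      using k_pos[OF that] by (simp add: k_def flip: real_sqrt_mult)
    then have "(\<Sum>x\<in>verts G. boundary u x * boundary u x) = k u + 1"
      unfolding sum_boundary[OF that] using k_pos[OF that] by (simp add: boundary_def)
    then show ?thesis using project[OF that] parseval[of u] by simp
  qed
  have "(\<Sum>u\<in>U. k u + 1) = (\<Sum>u\<in>U. \<Sum>i<n. (\<Sum>p\<in>A. g i p * star u p)\<^sup>2)"
    using energy by simp
  also have "\<dots> \<le> (\<Sum>i<card U. l ! i)"
  proof (rule sum_of_energies_le_sum_of_largest[OF fin_U _ _ gram star_orth])
    show "card U < n" using U by (simp add: n_def psubset_card_mono psubsetI)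
    have "sorted_wrt (\<ge>) l"
      unfolding l_def laplacian_eigenvalues_def
      by (simp add: sorted_wrt_rev sorted_sorted_list_of_multiset)
    then show "l ! j \<le> l ! i" if "i \<le> j" "j < n" for i j
      using that basis(1) by (cases "i = j") (auto simp: sorted_wrt_iff_nth_less)
  qed
  finally show ?thesis by (simp add: k_def out_def l_def)
qed

theorem theorem3p1:
  fixes G :: "('a, 'b) pre_digraph" and vs :: "'a list" and U :: "'a set" and n m :: nat
    and lam :: "nat \<Rightarrow> real"
  assumes "graph G" and "connected G"
    and "card (verts G) = n" and "n > 2"
    and "distinct vs" and "set vs = verts G"
    and "\<And>i. i \<in> {1..n} \<Longrightarrow> lam i = laplacian_eigenvalues G vs ! (i - 1)"
    and "U \<subseteq> verts G" and "card U = m" and "m < n"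
  shows "(\<Sum>i=1..m. lam i)
           \<ge> (\<Sum>u\<in>U. real (out_degree G u)) + real m - real (card (edges_within G U))"
proof -
  interpret graph G by fact
  have "U \<noteq> verts G" using assms by auto
  have in_verts: "arcs_ends G \<subseteq> verts G \<times> verts G" using adj_in_verts by auto
  have sym: "sym (arcs_ends G)" using sym_arcs by (simp add: symmetric_def)
  have irrefl: "irrefl (arcs_ends G)" using adj_not_same by (auto simp: irrefl_def)
  have cut: "\<forall>S\<subseteq>verts G. S \<noteq> {} \<longrightarrow> S \<noteq> verts G \<longrightarrow>
      (\<exists>x\<in>S. \<exists>y\<in>verts G - S. x \<rightarrow>\<^bsub>G\<^esub> y)"
    using connected_cut_edge[OF \<open>connected G\<close>] by blast
  obtain A where A: "A \<subseteq> arcs_ends G"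
    "\<forall>x y. x \<rightarrow>\<^bsub>G\<^esub> y \<longrightarrow> ((x, y) \<in> A \<longleftrightarrow> (y, x) \<notin> A)"
    "\<forall>x y. (x, y) \<in> A \<longrightarrow> y \<in> U \<longrightarrow> x \<in> U" "\<forall>u\<in>U. \<exists>y. (u, y) \<in> A"
    using exists_orientation_out_of[OF finite_verts in_verts sym irrefl cut
        \<open>U \<subseteq> verts G\<close> \<open>U \<noteq> verts G\<close>]
    by (elim exE conjE)
  have "(\<Sum>u\<in>U. card {y. (u, y) \<in> A}) + card (edges_within G U) = (\<Sum>u\<in>U. out_degree G u)"
    by (rule sum_out_degree_orientation[OF A(1) A(2)[rule_format] A(3)[rule_format] \<open>U \<subseteq> verts G\<close>])
  then have "(\<Sum>u\<in>U. real (out_degree G u)) + real m - real (card (edges_within G U))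
      = (\<Sum>u\<in>U. real (card {y. (u, y) \<in> A}) + 1)"
    using \<open>card U = m\<close> by (simp add: sum.distrib flip: of_nat_sum of_nat_add)
  also have "\<dots> \<le> (\<Sum>i<m. laplacian_eigenvalues G vs ! i)"
    unfolding \<open>card U = m\<close>[symmetric]
    by (rule sum_laplacian_eigenvalues_ge_stars[OF assms(5,6) A(1) A(2)[rule_format]
        \<open>U \<subseteq> verts G\<close> \<open>U \<noteq> verts G\<close> A(4)[rule_format]])
  also have "\<dots> = (\<Sum>i=1..m. lam i)"
  proof -
    have "(\<Sum>i=1..m. lam i) = (\<Sum>i<m. lam (Suc i))"
      by (simp add: sum.atLeast1_atMost_eq)
    then show ?thesis using assms(7) \<open>m < n\<close> by simp
  qed
  finally show ?thesis .
qed

end
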